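(* Let $\mathbb{K}$ be a field of characteristic $0$ and $\lambda\in\mathbb{K}$ nonzero. Let $A,B$ be $\mathbb{K}$-vector spaces equipped with linear maps $\mu:A\otimes A\to A$, $\nu:B\otimes B\to B$, $l:A\otimes B\to B$, $r:B\otimes A\to B$ and $P:B\to A$, and let $\pi_\lambda\in\mathfrak{h}_1$ be the element associated with $(\mu,\nu,l,r)$. Then $(A_\mu,B_\nu^{l,r},P)$ is a relative averaging algebra of weight $\lambda$ (that is, $A_\mu$ is an associative algebra, $B_\nu^{l,r}$ is an associative $A_\mu$-bimodule and $P:B\to A$ is a relative averaging operator of weight $\lambda$) if and only if $(s^{-1}\pi_\lambda,P)$ is a Maurer-Cartan element of the $L_\infty$-algebra $(s^{-1}\mathfrak{h}\oplus\mathfrak{a},\{l_k\}_{k=1}^\infty)$.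
   Context: Bimodules and operators. $A_\mu$ denotes $A$ with product $ab=\mu(a,b)$. $B_\nu^{l,r}$ is an associative $A_\mu$-bimodule if $xy=\nu(x,y)$ is associative and, with $a\cdot x=l(a,x)$, $x\cdot a=r(x,a)$: $(ab)\cdot x=a\cdot(b\cdot x)$, $(a\cdot x)\cdot b=a\cdot(x\cdot b)$, $(x\cdot a)\cdot b=x\cdot(ab)$, $(xy)\cdot a=x(y\cdot a)$, $(x\cdot a)y=x(a\cdot y)$, $(a\cdot x)y=a\cdot(xy)$ for $a,b\in A$, $x,y\in B$. $P$ is a relative averaging operator of weight $\lambda$ if $P(x)P(y)=P(P(x)\cdot y)=P(x\cdot P(y))=\lambda P(xy)$ for all $x,y\in B$. Trees. For $n\ge1$, $T_n$ is the set of planar rooted trees with $n+1$ leaves in which every internal vertex has at least two incoming edges. Leaves are labelled $0,\dots,n$ from left to right; deleting a leaf suppresses a vertex left with a single incoming edge. For $m,n\ge1$, $1\le i\le m$, $T\in T_{m+n-1}$: $R_0^{m;i,n}(T)\in T_m$ is obtained by deleting the leaves $i,\dots,i+n-2$, and $R_i^{m;i,n}(T)\in T_n$ by deleting all leaves except $i-1,\dots,i+n-1$. $T_1$ has one element. $T_2=\{T^{\dashv},T^{\vdash},T^{\perp}\}$: in $T^{\dashv}$ leaves 1,2 are joined at a vertex above the root vertex, in $T^{\vdash}$ leaves 0,1 are, and $T^{\perp}$ has one vertex with three leaves. Graded Lie algebra. With $D=A\oplus B$, $C^n(D,D)=\mathrm{Hom}(\mathbb{K}[T_n]\otimes D^{\otimes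 n},D)$ and $\mathfrak{g}=\bigoplus_{n\ge0}C^{n+1}(D,D)$ ($C^{n+1}$ in degree $n$), with bracket, for $f\in C^m$, $g\in C^n$, $$[f,g]=\sum_{i=1}^m(-1)^{(i-1)(n-1)}f\circ_ig-(-1)^{(m-1)(n-1)}\sum_{i=1}^n(-1)^{(i-1)(m-1)}g\circ_if,$$ $$(f\circ_ig)(T;x_1,\dots,x_{m+n-1})=f\big(R_0^{m;i,n}(T);x_1,\dots,x_{i-1},g(R_i^{m;i,n}(T);x_i,\dots,x_{i+n-1}),x_{i+n},\dots,x_{m+n-1}\big).$$ Let $\mathcal{A}^{k,l}$ be the direct sum of all $(k+l)$-fold tensor products of $A$'s and $B$'s with $A$ appearing $k$ times and $B$ appearing $l$ times. Let $\mathfrak{a}=\bigoplus_{n\ge0}\mathrm{Hom}(\mathbb{K}[T_{n+1}]\otimes B^{\otimes n+1},A)\subset\mathfrak{g}$, $p:\mathfrak{g}\to\mathfrak{g}$ the natural projection onto $\mathfrak{a}$, and $$\mathfrak{h}=\bigoplus_{n\ge0}\Big(\mathrm{Hom}(\mathbb{K}[T_{n+1}]\otimes A^{\otimes n+1},A)\oplus\bigoplus_{k+l=n+1,\,k\ge0,\,l>0}\mathrm{Hom}(\mathbb{K}[T_{n+1}]\otimes\mathcal{A}^{k,l},B)\Big),$$ a graded Lie subalgebra of $\mathfrak{g}$. The element $\pi_\lambda\in\mathfrak{h}_1$ is given by $\pi_\lambda(T^{\dashv};(a,x),(b,y))=(\mu(a,b),r(x,b))$, $\pi_\lambda(T^{\vdash};(a,x),(b,y))=(\mu(a,b),l(a,y))$,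 $\pi_\lambda(T^{\perp};(a,x),(b,y))=(\mu(a,b),\lambda\nu(x,y))$. $L_\infty$-algebras. An $L_\infty$-algebra is a graded vector space $\mathcal{L}$ with degree $1$ graded symmetric maps $l_k:\mathcal{L}^{\otimes k}\to\mathcal{L}$, $k\ge1$, satisfying $\sum_{i+j=n+1}\sum_{\sigma\in Sh(i,n-i)}\pm l_j(l_i(x_{\sigma(1)},\dots,x_{\sigma(i)}),x_{\sigma(i+1)},\dots,x_{\sigma(n)})=0$ (Koszul signs) for all $n\geq 1$. A Maurer-Cartan element is $\alpha\in\mathcal{L}_0$ with $\sum_{k\ge1}\frac1{k!}l_k(\alpha,\dots,\alpha)=0$. The $L_\infty$-structure on $s^{-1}\mathfrak{h}\oplus\mathfrak{a}$ (where $(s^{-1}\mathfrak{h})_n=\mathfrak{h}_{n+1}$) is $$l_2\big((s^{-1}f,0),(s^{-1}g,0)\big)=\big((-1)^{|f|}s^{-1}[f,g],0\big),$$ $$l_k\big((s^{-1}f,0),(0,h_1),\dots,(0,h_{k-1})\big)=\big(0,p[\cdots[[f,h_1],h_2],\dots,h_{k-1}]\big)\quad(k\ge2),$$ for homogeneous $f,g\in\mathfrak{h}$, $h_i\in\mathfrak{a}$; up to permutation of inputs all other maps vanish (in particular $l_1=0$). *)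

theory Defs
  imports Complex_Main "HOL-Library.Function_Algebras" "HOL-Library.Product_Plus"
begin

section \<open>Relative averaging algebras\<close>

text \<open>A linear map out of a tensor product is represented by the corresponding
  multilinear map.\<close>

definition bilinear_map ::
  "('k::field \<Rightarrow> 'u \<Rightarrow> 'u::ab_group_add) \<Rightarrow> ('k \<Rightarrow> 'v \<Rightarrow> 'v::ab_group_add) \<Rightarrow>
   ('k \<Rightarrow> 'w \<Rightarrow> 'w::ab_group_add) \<Rightarrow> ('u \<Rightarrow> 'v \<Rightarrow> 'w) \<Rightarrow> bool" where
  "bilinear_map sU sV sW f \<longleftrightarrow>
     (\<forall>u. Vector_Spaces.linear sV sW (\<lambda>v. f u v)) \<and>
     (\<forall>v. Vector_Spaces.linear sU sW (\<lambda>u. f u v))"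

definition associative_algebra ::
  "('k::field \<Rightarrow> 'a \<Rightarrow> 'a::ab_group_add) \<Rightarrow> ('a \<Rightarrow> 'a \<Rightarrow> 'a) \<Rightarrow> bool" where
  "associative_algebra sA mu \<longleftrightarrow>
     bilinear_map sA sA sA mu \<and> (\<forall>a b c. mu (mu a b) c = mu a (mu b c))"

definition associative_bimodule ::
  "('k::field \<Rightarrow> 'a \<Rightarrow> 'a::ab_group_add) \<Rightarrow> ('k \<Rightarrow> 'b \<Rightarrow> 'b::ab_group_add) \<Rightarrow>
   ('a \<Rightarrow> 'a \<Rightarrow> 'a) \<Rightarrow> ('b \<Rightarrow> 'b \<Rightarrow> 'b) \<Rightarrow> ('a \<Rightarrow> 'b \<Rightarrow> 'b) \<Rightarrow> ('b \<Rightarrow> 'a \<Rightarrow> 'b) \<Rightarrow> bool" where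
  "associative_bimodule sA sB mu nu l r \<longleftrightarrow>
     associative_algebra sB nu \<and>
     bilinear_map sA sB sB l \<and> bilinear_map sB sA sB r \<and>
     (\<forall>a b x. l (mu a b) x = l a (l b x)) \<and>
     (\<forall>a b x. r (l a x) b = l a (r x b)) \<and>
     (\<forall>a b x. r (r x a) b = r x (mu a b)) \<and>
     (\<forall>a x y. r (nu x y) a = nu x (r y a)) \<and>
     (\<forall>a x y. nu (r x a) y = nu x (l a y)) \<and>
     (\<forall>a x y. nu (l a x) y = l a (nu x y))"

definition relative_averaging_operator ::
  "('k::field \<Rightarrow> 'a \<Rightarrow> 'a::ab_group_add) \<Rightarrow> ('k \<Rightarrow> 'b \<Rightarrow> 'b::ab_group_add) \<Rightarrow> 'k \<Rightarrow>
   ('a \<Rightarrow> 'a \<Rightarrow> 'a) \<Rightarrow> ('b \<Rightarrow> 'b \<Rightarrow> 'b) \<Rightarrow> ('a \<Rightarrow> 'b \<Rightarrow> 'b) \<Rightarrow> ('b \<Rightarrow> 'a \<Rightarrow> 'b) \<Rightarrow> ('b \<Rightarrow> 'a) \<Rightarrow> bool" where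
  "relative_averaging_operator sA sB lam mu nu l r P \<longleftrightarrow>
     Vector_Spaces.linear sB sA P \<and>
     (\<forall>x y. mu (P x) (P y) = P (l (P x) y) \<and>
            P (l (P x) y) = P (r x (P y)) \<and>
            P (r x (P y)) = sA lam (P (nu x y)))"

definition relative_averaging_algebra ::
  "('k::field \<Rightarrow> 'a \<Rightarrow> 'a::ab_group_add) \<Rightarrow> ('k \<Rightarrow> 'b \<Rightarrow> 'b::ab_group_add) \<Rightarrow> 'k \<Rightarrow>
   ('a \<Rightarrow> 'a \<Rightarrow> 'a) \<Rightarrow> ('b \<Rightarrow> 'b \<Rightarrow> 'b) \<Rightarrow> ('a \<Rightarrow> 'b \<Rightarrow> 'b) \<Rightarrow> ('b \<Rightarrow> 'a \<Rightarrow> 'b) \<Rightarrow> ('b \<Rightarrow> 'a) \<Rightarrow> bool" where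
  "relative_averaging_algebra sA sB lam mu nu l r P \<longleftrightarrow>
     associative_algebra sA mu \<and>
     associative_bimodule sA sB mu nu l r \<and>
     relative_averaging_operator sA sB lam mu nu l r P"


section \<open>Planar rooted trees\<close>

datatype ptree = Leaf | Node "ptree list"

fun leaves :: "ptree \<Rightarrow> nat" where
  "leaves Leaf = 1"
| "leaves (Node ts) = sum_list (map leaves ts)"

fun wf_ptree :: "ptree \<Rightarrow> bool" where
  "wf_ptree Leaf \<longleftrightarrow> True"
| "wf_ptree (Node ts) \<longleftrightarrow> length ts \<ge> 2 \<and> (\<forall>t \<in> set ts. wf_ptree t)"

definition trees :: "nat \<Rightarrow> ptree set" where
  "trees n = {T. wf_ptree T \<and> leaves T = n + 1}"

text \<open>\<open>prune S k T\<close> deletes from \<open>T\<close>, whose leaves are labelled \<open>k, k + 1, \<dots>\<close> from left to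
  right, every leaf whose label is not in \<open>S\<close>; the result is \<open>None\<close> if no leaf survives.
  Vertices left with one incoming edge are suppressed.\<close>

fun suppress :: "ptree list \<Rightarrow> ptree option" where
  "suppress [] = None"
| "suppress [t] = Some t"
| "suppress ts = Some (Node ts)"

fun prune :: "nat set \<Rightarrow> nat \<Rightarrow> ptree \<Rightarrow> ptree option"
  and prune_list :: "nat set \<Rightarrow> nat \<Rightarrow> ptree list \<Rightarrow> ptree list" where
  "prune S k Leaf = (if k \<in> S then Some Leaf else None)"
| "prune S k (Node ts) = suppress (prune_list S k ts)"
| "prune_list S k [] = []"
| "prune_list S k (t # ts) =
     (case prune S k t of None \<Rightarrow> [] | Some t' \<Rightarrow> [t']) @ prune_list S (k + leaves t) ts"

text \<open>In \<open>R_outer m i n\<close> the leaves \<open>i, \<dots>, i + n - 2\<close> are deleted (none if \<open>n = 1\<close>), in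
  \<open>R_inner m i n\<close> the leaves \<open>i - 1, \<dots>, i + n - 1\<close> are kept; both are meant for trees with
  leaves \<open>0, \<dots>, m + n - 1\<close>.\<close>

definition R_outer :: "nat \<Rightarrow> nat \<Rightarrow> nat \<Rightarrow> ptree \<Rightarrow> ptree" where
  "R_outer m i n T = the (prune ({0..m + n - 1} - {i..<i + n - 1}) 0 T)"

definition R_inner :: "nat \<Rightarrow> nat \<Rightarrow> nat \<Rightarrow> ptree \<Rightarrow> ptree" where
  "R_inner m i n T = the (prune {i - 1..i + n - 1} 0 T)"

definition T_one :: ptree where "T_one = Node [Leaf, Leaf]"

definition T_dashv :: ptree where "T_dashv = Node [Leaf, Node [Leaf, Leaf]]"
definition T_vdash :: ptree where "T_vdash = Node [Node [Leaf, Leaf], Leaf]"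
definition T_perp :: ptree where "T_perp = Node [Leaf, Leaf, Leaf]"


section \<open>The graded Lie algebra of cochains\<close>

text \<open>An element of \<open>Hom (K[T_n] \<otimes> D^n, D)\<close> is a family, indexed by the basis \<open>T_n\<close> of
  \<open>K[T_n]\<close>, of \<open>n\<close>-linear maps on \<open>D\<close>, the \<open>n\<close> arguments being given as a list. Outside its
  domain it takes the value \<open>0\<close>, so that equality of functions is equality of cochains.\<close>

type_synonym ('a, 'b) cochain = "ptree \<Rightarrow> ('a \<times> 'b) list \<Rightarrow> 'a \<times> 'b"

definition scaleD ::
  "('k \<Rightarrow> 'a \<Rightarrow> 'a) \<Rightarrow> ('k \<Rightarrow> 'b \<Rightarrow> 'b) \<Rightarrow> 'k \<Rightarrow> 'a \<times> 'b \<Rightarrow> 'a \<times> 'b" where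
  "scaleD sA sB c z = (sA c (fst z), sB c (snd z))"

definition cochains ::
  "('k::field \<Rightarrow> 'a \<Rightarrow> 'a::ab_group_add) \<Rightarrow> ('k \<Rightarrow> 'b \<Rightarrow> 'b::ab_group_add) \<Rightarrow> nat \<Rightarrow>
   ('a, 'b) cochain set" where
  "cochains sA sB n = {f.
     (\<forall>T zs. \<not> (T \<in> trees n \<and> length zs = n) \<longrightarrow> f T zs = 0) \<and>
     (\<forall>T zs. \<forall>i<n. T \<in> trees n \<and> length zs = n \<longrightarrow>
        Vector_Spaces.linear (scaleD sA sB) (scaleD sA sB) (\<lambda>z. f T (zs[i := z])))}"

text \<open>Multiplication by \<open>(-1)^e\<close>.\<close>

definition sgn_mult :: "int \<Rightarrow> 'v::ab_group_add \<Rightarrow> 'v" where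
  "sgn_mult e v = (if even e then v else - v)"

text \<open>In \<open>circ m n i f g\<close> and \<open>lie_bracket m n f g\<close>, \<open>f\<close> and \<open>g\<close> are cochains on \<open>m\<close> and \<open>n\<close>
  arguments.\<close>

definition circ ::
  "nat \<Rightarrow> nat \<Rightarrow> nat \<Rightarrow> ('a::ab_group_add, 'b::ab_group_add) cochain \<Rightarrow> ('a, 'b) cochain \<Rightarrow>
   ('a, 'b) cochain" where
  "circ m n i f g = (\<lambda>T zs.
     if T \<in> trees (m + n - 1) \<and> length zs = m + n - 1
     then f (R_outer m i n T)
            (take (i - 1) zs @ [g (R_inner m i n T) (take n (drop (i - 1) zs))]
             @ drop (i - 1 + n) zs)
     else 0)"

definition lie_bracket ::
  "nat \<Rightarrow> nat \<Rightarrow> ('a::ab_group_add, 'b::ab_group_add) cochain \<Rightarrow> ('a, 'b) cochain \<Rightarrow>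
   ('a, 'b) cochain" where
  "lie_bracket m n f g =
     (\<Sum>i = 1..m. sgn_mult ((int i - 1) * (int n - 1)) (circ m n i f g))
     - sgn_mult ((int m - 1) * (int n - 1))
         (\<Sum>i = 1..n. sgn_mult ((int i - 1) * (int m - 1)) (circ n m i g f))"

text \<open>\<open>nested_bracket m f [(n\<^sub>1, h\<^sub>1), (n\<^sub>2, h\<^sub>2), \<dots>]\<close> is \<open>[\<cdots>[[f, h\<^sub>1], h\<^sub>2], \<dots>]\<close>, where
  \<open>f\<close> has \<open>m\<close> and \<open>h\<^sub>j\<close> has \<open>n\<^sub>j\<close> arguments.\<close>

fun nested_bracket ::
  "nat \<Rightarrow> ('a::ab_group_add, 'b::ab_group_add) cochain \<Rightarrow> (nat \<times> ('a, 'b) cochain) list \<Rightarrow>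
   ('a, 'b) cochain" where
  "nested_bracket m f [] = f"
| "nested_bracket m f ((n, h) # hs) = nested_bracket (m + n - 1) (lie_bracket m n f h) hs"

text \<open>The summands \<open>A\<close> and \<open>B\<close> of \<open>D\<close>. A list over \<open>A_part \<union> B_part\<close> stands for an elementary
  tensor in one of the tensor products of \<open>A\<close>'s and \<open>B\<close>'s that make up the tensor power of
  \<open>D\<close>; a cochain belongs to a sum of some of the Hom-spaces iff its components in the other
  ones vanish.\<close>

definition A_part :: "('a \<times> 'b::zero) set" where "A_part = {z. snd z = 0}"
definition B_part :: "('a::zero \<times> 'b) set" where "B_part = {z. fst z = 0}"

text \<open>The summands of degree \<open>d\<close> of \<open>\<aa>\<close> and \<open>\<hh>\<close>, consisting of cochains on \<open>d + 1\<close>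
  arguments; they vanish for \<open>d < 0\<close>.\<close>

definition a_space ::
  "('k::field \<Rightarrow> 'a \<Rightarrow> 'a::ab_group_add) \<Rightarrow> ('k \<Rightarrow> 'b \<Rightarrow> 'b::ab_group_add) \<Rightarrow> int \<Rightarrow>
   ('a, 'b) cochain set" where
  "a_space sA sB d =
     (if d < 0 then {0} else
      {f \<in> cochains sA sB (nat (d + 1)).
         \<forall>T zs. set zs \<subseteq> A_part \<union> B_part \<longrightarrow>
           (if set zs \<subseteq> B_part then f T zs \<in> A_part else f T zs = 0)})"

definition h_space ::
  "('k::field \<Rightarrow> 'a \<Rightarrow> 'a::ab_group_add) \<Rightarrow> ('k \<Rightarrow> 'b \<Rightarrow> 'b::ab_group_add) \<Rightarrow> int \<Rightarrow>
   ('a, 'b) cochain set" where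
  "h_space sA sB d =
     (if d < 0 then {0} else
      {f \<in> cochains sA sB (nat (d + 1)).
         \<forall>T zs. set zs \<subseteq> A_part \<union> B_part \<longrightarrow>
           (if set zs \<subseteq> A_part then f T zs \<in> A_part else f T zs \<in> B_part)})"

definition proj_a :: "('a::zero, 'b::zero) cochain \<Rightarrow> ('a, 'b) cochain" where
  "proj_a f = (\<lambda>T zs. (fst (f T (map (\<lambda>z. (0, snd z)) zs)), 0))"

definition pi_cochain ::
  "('k \<Rightarrow> 'b \<Rightarrow> 'b) \<Rightarrow> 'k \<Rightarrow> ('a \<Rightarrow> 'a \<Rightarrow> 'a::zero) \<Rightarrow> ('b \<Rightarrow> 'b \<Rightarrow> 'b::zero) \<Rightarrow>
   ('a \<Rightarrow> 'b \<Rightarrow> 'b) \<Rightarrow> ('b \<Rightarrow> 'a \<Rightarrow> 'b) \<Rightarrow> ('a, 'b) cochain" where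
  "pi_cochain sB lam mu nu l r = (\<lambda>T zs. case zs of
     [(a, x), (b, y)] \<Rightarrow>
       if T = T_dashv then (mu a b, r x b)
       else if T = T_vdash then (mu a b, l a y)
       else if T = T_perp then (mu a b, sB lam (nu x y))
       else 0
   | _ \<Rightarrow> 0)"

text \<open>A linear map from \<open>B\<close> to \<open>A\<close> as an element of degree \<open>0\<close> of \<open>\<aa>\<close>.\<close>

definition op_cochain :: "('b \<Rightarrow> 'a::zero) \<Rightarrow> ('a, 'b::zero) cochain" where
  "op_cochain P = (\<lambda>T zs. case zs of [(a, x)] \<Rightarrow> if T = T_one then (P x, 0) else 0 | _ \<Rightarrow> 0)"


section \<open>The L-infinity structure and its Maurer-Cartan elements\<close>

text \<open>A pair \<open>(f, h)\<close> stands for \<open>(s^{-1} f, h)\<close>.\<close>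

definition L_space ::
  "('k::field \<Rightarrow> 'a \<Rightarrow> 'a::ab_group_add) \<Rightarrow> ('k \<Rightarrow> 'b \<Rightarrow> 'b::ab_group_add) \<Rightarrow> int \<Rightarrow>
   (('a, 'b) cochain \<times> ('a, 'b) cochain) set" where
  "L_space sA sB d = h_space sA sB (d + 1) \<times> a_space sA sB d"

definition scaleL ::
  "('k \<Rightarrow> 'a \<Rightarrow> 'a) \<Rightarrow> ('k \<Rightarrow> 'b \<Rightarrow> 'b) \<Rightarrow> 'k \<Rightarrow> ('a, 'b) cochain \<times> ('a, 'b) cochain \<Rightarrow>
   ('a, 'b) cochain \<times> ('a, 'b) cochain" where
  "scaleL sA sB c u =
     ((\<lambda>T zs. scaleD sA sB c (fst u T zs)), (\<lambda>T zs. scaleD sA sB c (snd u T zs)))"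

text \<open>The bracket \<open>l_k\<close> on homogeneous elements, each given together with its degree in
  \<open>L_space\<close>. This is the multilinear graded symmetric extension of the two defining formulas
  (see \<open>linf_h_h\<close> and \<open>linf_h_a\<close> below): expanding \<open>(f, h) = (f, 0) + (0, h)\<close> in every argument,
  the surviving terms have exactly one argument from the first summand, or are \<open>l_2\<close> of two
  such arguments. Moving the argument number \<open>i\<close> to the front past the previous ones gives the
  Koszul sign. If \<open>f\<close> has degree \<open>d\<close> in \<open>L_space\<close>, then it has degree \<open>d + 1\<close> in \<open>\<hh>\<close>
  and \<open>d + 2\<close> arguments.\<close>

definition linf ::
  "nat \<Rightarrow> (int \<times> ('a::ab_group_add, 'b::ab_group_add) cochain \<times> ('a, 'b) cochain) list \<Rightarrow>
   ('a, 'b) cochain \<times> ('a, 'b) cochain" where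
  "linf k us =
    (let d = (\<lambda>i. fst (us ! i)); f = (\<lambda>i. fst (snd (us ! i))) in
     (if k = 2
      then sgn_mult (d 0 + 1) (lie_bracket (nat (d 0 + 2)) (nat (d 1 + 2)) (f 0) (f 1))
      else 0,
      if k \<ge> 2
      then (\<Sum>i<k. sgn_mult (d i * (\<Sum>j<i. d j))
              (proj_a (nested_bracket (nat (d i + 2)) (f i)
                 (map (\<lambda>(e, g, h). (nat (e + 1), h)) (take i us @ drop (Suc i) us)))))
      else 0))"

lemma cochain_zero_arg:
  assumes "f \<in> cochains sA sB n" "zs ! i = 0" "i < n"
  shows "f T zs = 0"
proof (cases "T \<in> trees n \<and> length zs = n")
  case True
  then have "Vector_Spaces.linear (scaleD sA sB) (scaleD sA sB) (\<lambda>z. f T (zs[i := z]))"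
    using assms by (auto simp: cochains_def)
  then interpret Vector_Spaces.linear "scaleD sA sB" "scaleD sA sB" "\<lambda>z. f T (zs[i := z])" .
  have "f T (zs[i := 0]) = 0" by (rule zero)
  then show ?thesis using assms(2) by (metis list_update_id)
qed (use assms in \<open>auto simp: cochains_def\<close>)

lemma circ_zero_left: "circ m n i 0 g = 0"
  by (auto simp: circ_def fun_eq_iff)

lemma circ_zero_right:
  assumes "f \<in> cochains sA sB m" "i \<in> {1..m}"
  shows "circ m n i f 0 = 0"
proof (intro ext)
  fix T :: ptree and zs :: "('a \<times> 'b) list"
  show "circ m n i f 0 T zs = 0 T zs"
  proof (cases "length zs = m + n - 1")
    case True
    then have "length (take (i - 1) zs) = i - 1"
      using assms(2) True by (auto simp: min_def)
    then have "(take (i - 1) zs @ [0] @ drop (i - 1 + n) zs) ! (i - 1) = 0"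
      by (metis append_Cons nth_append_length)
    then have "f (R_outer m i n T) (take (i - 1) zs @ [0] @ drop (i - 1 + n) zs) = 0"
      using assms(2) by (intro cochain_zero_arg[OF assms(1), where i = "i - 1"]) auto
    then show ?thesis by (simp only: circ_def zero_fun_apply if_cancel)
  qed (auto simp: circ_def)
qed

lemma sgn_mult_zero [simp]: "sgn_mult e 0 = 0"
  by (simp add: sgn_mult_def)

lemma lie_bracket_zero:
  assumes "f \<in> cochains sA sB m \<or> f = 0"
  shows "lie_bracket m n f 0 = 0" "lie_bracket n m 0 f = 0"
proof -
  have "circ m n i f 0 = 0" if "i \<in> {1..m}" for i
    using assms circ_zero_right[OF _ that] circ_zero_left by blast
  then show "lie_bracket m n f 0 = 0" "lie_bracket n m 0 f = 0"
    by (simp_all add: lie_bracket_def circ_zero_left)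
qed

lemma nested_bracket_zero:
  assumes "\<forall>(n, h) \<in> set hs. h \<in> cochains sA sB n \<or> h = 0"
  shows "nested_bracket m 0 hs = 0"
  using assms
proof (induction hs arbitrary: m)
  case (Cons q hs)
  obtain n h where q: "q = (n, h)" by force
  have "h \<in> cochains sA sB n \<or> h = 0"
    using bspec[OF Cons.prems, of q] unfolding q by (simp only: list.set_intros prod.case)
  then have "lie_bracket m n 0 h = 0"
    by (rule lie_bracket_zero(2))
  moreover have "nested_bracket (m + n - 1) 0 hs = 0"
    by (intro Cons.IH ballI bspec[OF Cons.prems list.set_intros(2)])
  ultimately show ?case by (simp only: q nested_bracket.simps)
qed simp

lemma proj_a_zero [simp]: "proj_a 0 = 0"
  by (auto simp: proj_a_def fun_eq_iff zero_prod_def)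

lemma h_space_cases: "f \<in> h_space sA sB d \<Longrightarrow> f \<in> cochains sA sB (nat (d + 1)) \<or> f = 0"
  by (auto simp: h_space_def split: if_splits)

lemma a_space_cases: "h \<in> a_space sA sB d \<Longrightarrow> h \<in> cochains sA sB (nat (d + 1)) \<or> h = 0"
  by (auto simp: a_space_def split: if_splits)

lemma linf_h_h:
  assumes "f \<in> h_space sA sB d" "g \<in> h_space sA sB e"
  shows "linf 2 [(d - 1, f, 0), (e - 1, g, 0)] =
    (sgn_mult d (lie_bracket (nat (d + 1)) (nat (e + 1)) f g), 0)"
  using h_space_cases[OF assms(1)] h_space_cases[OF assms(2)]
  by (simp add: linf_def Let_def numeral_2_eq_2 lie_bracket_zero add.commute)

lemma linf_h_a:
  assumes f: "f \<in> h_space sA sB d" and "hs \<noteq> []"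
    and hs: "\<forall>(e, h) \<in> set hs. h \<in> a_space sA sB e"
  shows "linf (Suc (length hs)) ((d - 1, f, 0) # map (\<lambda>(e, h). (e, 0, h)) hs) =
    (0, proj_a (nested_bracket (nat (d + 1)) f (map (\<lambda>(e, h). (nat (e + 1), h)) hs)))"
proof -
  define us where "us = (d - 1, f, 0) # map (\<lambda>(e, h). (e, 0 :: ('a, 'b) cochain, h)) hs"
  define args where "args = (\<lambda>i. map (\<lambda>(e, g, h). (nat (e + 1), h)) (take i us @ drop (Suc i) us))"
  let ?t = "\<lambda>i. sgn_mult (fst (us ! i) * (\<Sum>j<i. fst (us ! j)))
     (proj_a (nested_bracket (nat (fst (us ! i) + 2)) (fst (snd (us ! i))) (args i)))"
  have h: "\<forall>(n, h) \<in> set (args i). h \<in> cochains sA sB n \<or> h = 0" for i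
  proof -
    have 1: "set (take i us @ drop (Suc i) us) \<subseteq> set us"
      using set_take_subset set_drop_subset by fastforce
    have 2: "h \<in> cochains sA sB (nat (e + 1)) \<or> h = 0" if "(e, g, h) \<in> set us" for e g h
      using that hs by (auto simp: us_def dest!: a_space_cases)
    have "snd w \<in> cochains sA sB (fst w) \<or> snd w = 0" if w: "w \<in> set (args i)" for w
    proof -
      obtain v where v: "v \<in> set (take i us @ drop (Suc i) us)"
        "w = (case v of (e, g, h) \<Rightarrow> (nat (e + 1), h))"
        using w unfolding args_def set_map by blast
      obtain e g h where "v = (e, g, h)" by (cases v)
      with v have "(e, g, h) \<in> set (take i us @ drop (Suc i) us)" "w = (nat (e + 1), h)"
        by (simp_all only: prod.case)
      then show ?thesis using 2[OF subsetD[OF 1]] by (simp only: fst_conv snd_conv)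
    qed
    then show ?thesis unfolding case_prod_unfold by (rule ballI)
  qed
  have 0: "?t (Suc i) = 0" if "i < length hs" for i
  proof -
    have "fst (snd (us ! Suc i)) = 0"
      using that by (simp add: us_def split: prod.split)
    then show ?thesis using nested_bracket_zero[OF h] by simp
  qed
  have sum0: "(\<Sum>i<Suc n. t i) = t 0" if "\<And>i. i < n \<Longrightarrow> t (Suc i) = 0"
    for n and t :: "nat \<Rightarrow> ('a, 'b) cochain"
    using that by (simp add: sum.lessThan_Suc_shift del: sum.lessThan_Suc)
  have "(\<Sum>i<Suc (length hs). ?t i) = ?t 0"
    by (rule sum0) (rule 0)
  also have "\<dots> = proj_a (nested_bracket (nat (d + 1)) f (map (\<lambda>(e, h). (nat (e + 1), h)) hs))"
    by (simp add: args_def us_def sgn_mult_def case_prod_unfold comp_def add.commute)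
  finally have snd: "(\<Sum>i<Suc (length hs). ?t i) =
    proj_a (nested_bracket (nat (d + 1)) f (map (\<lambda>(e, h). (nat (e + 1), h)) hs))" .
  have fst: "lie_bracket (nat (fst (us ! 0) + 2)) (nat (fst (us ! 1) + 2))
      (fst (snd (us ! 0))) (fst (snd (us ! 1))) = 0"
  proof -
    have us0: "us ! 0 = (d - 1, f, 0)"
      by (simp only: us_def nth_Cons_0)
    have us1: "fst (snd (us ! 1)) = 0"
      using \<open>hs \<noteq> []\<close> by (cases hs) (simp_all add: us_def case_prod_unfold)
    have "d - 1 + 2 = d + 1" by simp
    with h_space_cases[OF f] show ?thesis
      unfolding us0 us1 fst_conv snd_conv by (intro lie_bracket_zero(1)) (simp only:)
  qed
  have k: "(2 \<le> Suc (length hs)) = True"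
    using \<open>hs \<noteq> []\<close> by (cases hs) simp_all
  show ?thesis
    unfolding us_def[symmetric] linf_def Let_def
    by (simp only: k snd[unfolded args_def] fst sgn_mult_zero if_cancel if_True)
qed

text \<open>The Maurer-Cartan equation has a meaning if only finitely many of its terms are nonzero;
  this is part of the definition.\<close>

definition maurer_cartan ::
  "('k::field \<Rightarrow> 'v \<Rightarrow> 'v::ab_group_add) \<Rightarrow> (int \<Rightarrow> 'v set) \<Rightarrow>
   (nat \<Rightarrow> (int \<times> 'v) list \<Rightarrow> 'v) \<Rightarrow> 'v \<Rightarrow> bool" where
  "maurer_cartan sc L br u \<longleftrightarrow>
     u \<in> L 0 \<and>
     finite {k. k \<ge> 1 \<and> br k (replicate k (0, u)) \<noteq> 0} \<and>
     (\<Sum>k | k \<ge> 1 \<and> br k (replicate k (0, u)) \<noteq> 0.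
        sc (inverse (of_nat (fact k))) (br k (replicate k (0, u)))) = 0"

end

theory Submission
  imports Defs
begin

text \<open>
  Write \<open>\<pi>\<close> for the cochain of \<open>(\<mu>, \<nu>, l, r)\<close>. Since \<open>P\<close> is defined on \<open>B\<close> and vanishes on
  \<open>A\<close>, it squares to zero as an endomorphism of \<open>A \<oplus> B\<close>, and \<open>[[[\<pi>, P], P], P] = 0\<close>. Hence only
  \<open>l\<^sub>2\<close> and \<open>l\<^sub>3\<close> contribute to the Maurer-Cartan equation, which splits into \<open>[\<pi>, \<pi>] = 0\<close> and
  \<open>p[\<pi>, P] + 1/2 p[[\<pi>, P], P] = 0\<close>. The first equation says that \<open>\<pi> \<circ>\<^sub>1 \<pi> = \<pi> \<circ>\<^sub>2 \<pi>\<close>; on the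
  eleven trees with four leaves this gives the associativity and bimodule axioms, some of them
  multiplied by \<open>\<lambda>\<close> or \<open>\<lambda>\<^sup>2\<close>. The second one, on the three trees with three leaves, gives the three
  averaging identities: \<open>[\<pi>, P]\<close> contributes the term of weight \<open>\<lambda>\<close>, \<open>[[\<pi>, P], P]\<close> the others.
\<close>

section \<open>Trees with at most four leaves\<close>

lemma leaves_pos: "wf_ptree T \<Longrightarrow> 0 < leaves T"
proof (induction T)
  case (Node ts)
  then obtain t us where "ts = t # us" by (cases ts) auto
  with Node show ?case by simp
qed simp

lemma length_le_leaves:
  "\<forall>t \<in> set ts. wf_ptree t \<Longrightarrow> length ts \<le> sum_list (map leaves ts)"
proof (induction ts)
  case (Cons t ts)
  then show ?case using leaves_pos[of t] by simp
qed simp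

lemma leaves_eq_1_iff: "wf_ptree T \<Longrightarrow> leaves T = Suc 0 \<longleftrightarrow> T = Leaf"
  using length_le_leaves by (cases T) fastforce+

text \<open>Every subtree has a leaf, so a tree other than \<open>Leaf\<close> with at most four
  leaves has two to four subtrees at its root. These are the cases of the enumerations
  below.\<close>

lemma length_2_to_4_cases:
  assumes "2 \<le> length ts" "length ts \<le> 4"
  obtains a b where "ts = [a, b]" | a b c where "ts = [a, b, c]" | a b c d where "ts = [a, b, c, d]"
proof -
  have "length ts = 2 \<or> length ts = 3 \<or> length ts = 4" using assms by linarith
  then show ?thesis using that by (auto simp: numeral_eq_Suc length_Suc_conv)
qed

lemma wf_ptree_2_leaves:
  assumes "wf_ptree T" "leaves T = 2"
  shows "T = Node [Leaf, Leaf]"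
proof (cases T)
  case (Node ts)
  then have wf: "\<forall>t \<in> set ts. wf_ptree t" "2 \<le> length ts"
    and sum: "sum_list (map leaves ts) = 2" using assms by auto
  then have "length ts \<le> 4" using length_le_leaves[OF wf(1)] by simp
  from wf(2) this show ?thesis
  proof (cases ts rule: length_2_to_4_cases)
    case (1 a b)
    with wf sum have "leaves a = Suc 0" "leaves b = Suc 0"
      using leaves_pos[of a] leaves_pos[of b] by auto
    then show ?thesis using 1 wf Node by (simp add: leaves_eq_1_iff)
  qed (use sum length_le_leaves[OF wf(1)] in auto)
qed (use assms in simp)

lemma wf_ptree_3_leaves:
  assumes "wf_ptree T" "leaves T = 3"
  shows "T \<in> {T_dashv, T_vdash, T_perp}"
proof (cases T)
  case (Node ts)
  then have wf: "\<forall>t \<in> set ts. wf_ptree t" "2 \<le> length ts"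
    and sum: "sum_list (map leaves ts) = 3" using assms by auto
  then have "length ts \<le> 4" using length_le_leaves[OF wf(1)] by simp
  from wf(2) this show ?thesis
  proof (cases ts rule: length_2_to_4_cases)
    case (1 a b)
    with wf sum have "leaves a = Suc 0 \<and> leaves b = 2 \<or> leaves a = 2 \<and> leaves b = Suc 0"
      using leaves_pos[of a] leaves_pos[of b] by auto
    then show ?thesis using 1 wf Node
      by (auto simp: leaves_eq_1_iff T_dashv_def T_vdash_def dest: wf_ptree_2_leaves)
  next
    case (2 a b c)
    with wf sum have "leaves a = Suc 0" "leaves b = Suc 0" "leaves c = Suc 0"
      using leaves_pos[of a] leaves_pos[of b] leaves_pos[of c] by auto
    then show ?thesis using 2 wf Node by (simp add: leaves_eq_1_iff T_perp_def)
  qed (use sum length_le_leaves[OF wf(1)] in auto)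
qed (use assms in simp)

lemma trees_2: "trees 2 = {T_dashv, T_vdash, T_perp}"
  using wf_ptree_3_leaves
  by (auto simp: trees_def numeral_3_eq_3 T_dashv_def T_vdash_def T_perp_def)

text \<open>Sorted by how the four leaves split among the subtrees at the root: 1+3 and 3+1 give six
  trees, 2+2 gives one, the three arrangements of 1+1+2 give one each, and 1+1+1+1 is the
  corolla.\<close>

lemma trees_3:
  "trees 3 = (\<Union>S \<in> {T_dashv, T_vdash, T_perp}. {Node [Leaf, S], Node [S, Leaf]}) \<union>
    {Node [T_one, T_one], Node [T_one, Leaf, Leaf], Node [Leaf, T_one, Leaf],
     Node [Leaf, Leaf, T_one], Node [Leaf, Leaf, Leaf, Leaf]}" (is "_ = ?R")
proof
  show "?R \<subseteq> trees 3"
    by (auto simp: trees_def T_one_def T_dashv_def T_vdash_def T_perp_def)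
  show "trees 3 \<subseteq> ?R"
  proof
    fix T assume "T \<in> trees 3"
    then have T: "wf_ptree T" "leaves T = 4" by (auto simp: trees_def)
    show "T \<in> ?R"
    proof (cases T)
      case (Node ts)
      then have wf: "\<forall>t \<in> set ts. wf_ptree t" "2 \<le> length ts"
        and sum: "sum_list (map leaves ts) = 4" using T by auto
      then have "length ts \<le> 4" using length_le_leaves[OF wf(1)] by simp
      from wf(2) this show ?thesis
      proof (cases ts rule: length_2_to_4_cases)
        case (1 a b)
        with wf sum have "leaves a = Suc 0 \<and> leaves b = 3 \<or> leaves a = 2 \<and> leaves b = 2 \<or>
            leaves a = 3 \<and> leaves b = Suc 0"
          using leaves_pos[of a] leaves_pos[of b] by auto
        then show ?thesis using 1 wf Node
          by (auto simp: leaves_eq_1_iff T_one_def dest: wf_ptree_2_leaves wf_ptree_3_leaves)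
      next
        case (2 a b c)
        with wf sum have "leaves a = Suc 0 \<and> leaves b = Suc 0 \<and> leaves c = 2 \<or>
            leaves a = Suc 0 \<and> leaves b = 2 \<and> leaves c = Suc 0 \<or>
            leaves a = 2 \<and> leaves b = Suc 0 \<and> leaves c = Suc 0"
          using leaves_pos[of a] leaves_pos[of b] leaves_pos[of c] by auto
        then show ?thesis using 2 wf Node
          by (auto simp: leaves_eq_1_iff T_one_def dest: wf_ptree_2_leaves)
      next
        case (3 a b c d)
        with wf sum have "leaves a = Suc 0" "leaves b = Suc 0" "leaves c = Suc 0" "leaves d = Suc 0"
          using leaves_pos[of a] leaves_pos[of b] leaves_pos[of c] leaves_pos[of d] by auto
        then show ?thesis using 3 wf Node by (simp add: leaves_eq_1_iff)
      qed
    qed (use T in simp)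
  qed
qed

section \<open>Restriction maps on small trees and partial compositions\<close>

lemma T_distinct: "T_dashv \<noteq> T_vdash" "T_dashv \<noteq> T_perp" "T_vdash \<noteq> T_perp"
  by (simp_all add: T_dashv_def T_vdash_def T_perp_def)

text \<open>Inserting a one-argument cochain deletes no leaf, and restricting to two leaves always
  gives \<open>T_one\<close>. Hence composing with \<open>opP\<close> on either side keeps the tree
  at which the two-argument cochain is evaluated.\<close>

lemma R_trees_2:
  assumes "T \<in> trees 2"
  shows "R_outer 2 1 1 T = T" "R_outer 2 2 1 T = T" "R_inner 2 1 1 T = T_one"
    "R_inner 2 2 1 T = T_one"
    "R_outer 1 1 2 T = T_one" "R_inner 1 1 2 T = T"
  using assms
  by (auto simp: trees_2 R_outer_def R_inner_def T_one_def T_dashv_def T_vdash_def T_perp_def)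

lemma circ_2_2:
  assumes "T \<in> trees 3"
  shows "circ 2 2 1 f g T [u, v, w] = f (R_outer 2 1 2 T) [g (R_inner 2 1 2 T) [u, v], w]"
    "circ 2 2 2 f g T [u, v, w] = f (R_outer 2 2 2 T) [u, g (R_inner 2 2 2 T) [v, w]]"
  using assms by (simp_all add: circ_def numeral_eq_Suc)

text \<open>Outside \<open>trees 3\<close> and lists of length three both compositions have the
  default value 0, so equality of cochains becomes a check on the eleven trees.\<close>

lemma circ_2_2_eq_iff:
  "circ 2 2 1 f g = circ 2 2 2 f g \<longleftrightarrow> (\<forall>T \<in> trees 3. \<forall>u v w.
     f (R_outer 2 1 2 T) [g (R_inner 2 1 2 T) [u, v], w] =
     f (R_outer 2 2 2 T) [u, g (R_inner 2 2 2 T) [v, w]])" (is "?L \<longleftrightarrow> ?R")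
proof
  assume ?L
  then show ?R using circ_2_2 by metis
next
  assume R: ?R
  show ?L
  proof (intro ext)
    fix T zs
    show "circ 2 2 1 f g T zs = circ 2 2 2 f g T zs"
    proof (cases "T \<in> trees 3 \<and> length zs = 3")
      case True
      then obtain u v w where "zs = [u, v, w]" by (auto simp: numeral_3_eq_3 length_Suc_conv)
      then show ?thesis using True R[rule_format, of T u v w] by (simp only: circ_2_2)
    qed (auto simp: circ_def)
  qed
qed

text \<open>The first composition deletes leaf 1 (outer) and keeps leaves 0, 1, 2 (inner); the
  second deletes leaf 2 and keeps leaves 1, 2, 3.\<close>

lemma R_trees_3:
  "R_inner 2 1 2 (Node [Leaf, T_dashv]) = T_dashv" "R_outer 2 1 2 (Node [Leaf, T_dashv]) = T_dashv"
  "R_inner 2 2 2 (Node [Leaf, T_dashv]) = T_dashv" "R_outer 2 2 2 (Node [Leaf, T_dashv]) = T_dashv"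
  "R_inner 2 1 2 (Node [Leaf, T_vdash]) = T_dashv" "R_outer 2 1 2 (Node [Leaf, T_vdash]) = T_dashv"
  "R_inner 2 2 2 (Node [Leaf, T_vdash]) = T_vdash" "R_outer 2 2 2 (Node [Leaf, T_vdash]) = T_dashv"
  "R_inner 2 1 2 (Node [Leaf, T_perp]) = T_dashv" "R_outer 2 1 2 (Node [Leaf, T_perp]) = T_dashv"
  "R_inner 2 2 2 (Node [Leaf, T_perp]) = T_perp" "R_outer 2 2 2 (Node [Leaf, T_perp]) = T_dashv"
  "R_inner 2 1 2 (Node [T_dashv, Leaf]) = T_dashv" "R_outer 2 1 2 (Node [T_dashv, Leaf]) = T_vdash"
  "R_inner 2 2 2 (Node [T_dashv, Leaf]) = T_vdash" "R_outer 2 2 2 (Node [T_dashv, Leaf]) = T_vdash"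
  "R_inner 2 1 2 (Node [T_vdash, Leaf]) = T_vdash" "R_outer 2 1 2 (Node [T_vdash, Leaf]) = T_vdash"
  "R_inner 2 2 2 (Node [T_vdash, Leaf]) = T_vdash" "R_outer 2 2 2 (Node [T_vdash, Leaf]) = T_vdash"
  "R_inner 2 1 2 (Node [T_perp, Leaf]) = T_perp" "R_outer 2 1 2 (Node [T_perp, Leaf]) = T_vdash"
  "R_inner 2 2 2 (Node [T_perp, Leaf]) = T_vdash" "R_outer 2 2 2 (Node [T_perp, Leaf]) = T_vdash"
  "R_inner 2 1 2 (Node [T_one, T_one]) = T_vdash" "R_outer 2 1 2 (Node [T_one, T_one]) = T_dashv"
  "R_inner 2 2 2 (Node [T_one, T_one]) = T_dashv" "R_outer 2 2 2 (Node [T_one, T_one]) = T_vdash"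
  "R_inner 2 1 2 (Node [T_one, Leaf, Leaf]) = T_vdash" "R_outer 2 1 2 (Node [T_one, Leaf, Leaf]) = T_perp"
  "R_inner 2 2 2 (Node [T_one, Leaf, Leaf]) = T_perp" "R_outer 2 2 2 (Node [T_one, Leaf, Leaf]) = T_vdash"
  "R_inner 2 1 2 (Node [Leaf, T_one, Leaf]) = T_dashv" "R_outer 2 1 2 (Node [Leaf, T_one, Leaf]) = T_perp"
  "R_inner 2 2 2 (Node [Leaf, T_one, Leaf]) = T_vdash" "R_outer 2 2 2 (Node [Leaf, T_one, Leaf]) = T_perp"
  "R_inner 2 1 2 (Node [Leaf, Leaf, T_one]) = T_perp" "R_outer 2 1 2 (Node [Leaf, Leaf, T_one]) = T_dashv"
  "R_inner 2 2 2 (Node [Leaf, Leaf, T_one]) = T_dashv" "R_outer 2 2 2 (Node [Leaf, Leaf, T_one]) = T_perp"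
  "R_inner 2 1 2 (Node [Leaf, Leaf, Leaf, Leaf]) = T_perp"
  "R_outer 2 1 2 (Node [Leaf, Leaf, Leaf, Leaf]) = T_perp"
  "R_inner 2 2 2 (Node [Leaf, Leaf, Leaf, Leaf]) = T_perp"
  "R_outer 2 2 2 (Node [Leaf, Leaf, Leaf, Leaf]) = T_perp"
  by (simp_all add: R_outer_def R_inner_def T_one_def T_dashv_def T_vdash_def T_perp_def)

lemma cochain_2_eqI:
  fixes f g :: "ptree \<Rightarrow> 'd list \<Rightarrow> 'e"
  assumes "\<And>T zs. \<not> (T \<in> trees 2 \<and> length zs = 2) \<Longrightarrow> f T zs = g T zs"
    and "\<And>T z w. T \<in> trees 2 \<Longrightarrow> f T [z, w] = g T [z, w]"
  shows "f = g"
proof (intro ext)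
  fix T zs
  show "f T zs = g T zs"
    using assms by (cases "T \<in> trees 2 \<and> length zs = 2") (auto simp: numeral_2_eq_2 length_Suc_conv)
qed

section \<open>The structure cochain\<close>

lemma bilinear_mapD:
  assumes "bilinear_map s t u f"
  shows "f (x + y) v = f x v + f y v" "f x (v + w) = f x v + f x w"
    "f (s c x) v = u c (f x v)" "f x (t c v) = u c (f x v)"
    "f 0 v = 0" "f x 0 = 0"
proof -
  have 1: "Vector_Spaces.linear t u (f x)" "Vector_Spaces.linear s u (\<lambda>x. f x v)" for x v
    using assms by (auto simp: bilinear_map_def)
  show add: "f (x + y) v = f x v + f y v" "f x (v + w) = f x v + f x w" for x y v w
    using 1 by (simp_all add: Vector_Spaces.linear_iff)
  show "f (s c x) v = u c (f x v)" "f x (t c v) = u c (f x v)"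
    using 1 by (simp_all add: Vector_Spaces.linear_iff)
  show "f 0 v = 0" "f x 0 = 0"
    using add(1)[of 0 0 v] add(2)[of x 0 0] by simp_all
qed

locale averaging_data =
  A: vector_space sA + B: vector_space sB
  for sA :: "'k::field_char_0 \<Rightarrow> 'a::ab_group_add \<Rightarrow> 'a"
    and sB :: "'k \<Rightarrow> 'b::ab_group_add \<Rightarrow> 'b" +
  fixes lam :: 'k
    and mu :: "'a \<Rightarrow> 'a \<Rightarrow> 'a"
    and nu :: "'b \<Rightarrow> 'b \<Rightarrow> 'b"
    and l :: "'a \<Rightarrow> 'b \<Rightarrow> 'b"
    and r :: "'b \<Rightarrow> 'a \<Rightarrow> 'b"
    and P :: "'b \<Rightarrow> 'a"
  assumes lam: "lam \<noteq> 0"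
    and mu: "bilinear_map sA sA sA mu"
    and nu: "bilinear_map sB sB sB nu"
    and l: "bilinear_map sA sB sB l"
    and r: "bilinear_map sB sA sB r"
    and P: "Vector_Spaces.linear sB sA P"
begin

abbreviation "sD \<equiv> scaleD sA sB"
abbreviation "pi2 \<equiv> pi_cochain sB lam mu nu l r"
abbreviation "opP \<equiv> op_cochain P"

lemmas bilinear_simps =
  bilinear_mapD[OF mu] bilinear_mapD[OF nu] bilinear_mapD[OF l] bilinear_mapD[OF r]

lemma P_simps: "P (x + y) = P x + P y" "P (sB c x) = sA c (P x)" "P 0 = 0" "P (- x) = - P x"
  "P (x - y) = P x - P y"
proof -
  interpret P: Vector_Spaces.linear sB sA P by (rule P)
  show "P (x + y) = P x + P y" "P (sB c x) = sA c (P x)" "P 0 = 0" "P (- x) = - P x"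
    "P (x - y) = P x - P y"
    by (simp_all add: P.add P.scale P.zero P.neg P.diff)
qed

lemma vector_space_sD: "vector_space sD"
  by unfold_locales
    (auto simp: scaleD_def A.scale_right_distrib A.scale_left_distrib
      B.scale_right_distrib B.scale_left_distrib)

lemma pi2_simps:
  "pi2 T_dashv [z, w] = (mu (fst z) (fst w), r (snd z) (fst w))"
  "pi2 T_vdash [z, w] = (mu (fst z) (fst w), l (fst z) (snd w))"
  "pi2 T_perp [z, w] = (mu (fst z) (fst w), sB lam (nu (snd z) (snd w)))"
  using T_distinct by (cases z; cases w; simp add: pi_cochain_def)+

lemma pi2_eq_0: "\<not> (T \<in> trees 2 \<and> length zs = 2) \<Longrightarrow> pi2 T zs = 0"
  by (auto simp: pi_cochain_def trees_2 split: list.split)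

lemma opP_simps: "opP T_one [z] = (P (snd z), 0)"
  by (cases z) (simp add: op_cochain_def)

text \<open>Desuspension turns degree 1 into the degree 0 demanded of a Maurer-Cartan element. An
  argument in \<open>B_part\<close> makes \<open>mu\<close> vanish; if all arguments lie in
  \<open>A_part\<close>, then \<open>r\<close>, \<open>l\<close> and \<open>nu\<close> each receive
  a zero.\<close>

lemma pi2_mem: "pi2 \<in> h_space sA sB 1"
proof -
  have "Vector_Spaces.linear sD sD (\<lambda>z. pi2 T (zs[i := z]))"
    if T: "T \<in> trees 2" and zs: "length zs = 2" and i: "i < 2" for T zs i
  proof -
    obtain u v where "zs = [u, v]" using zs by (auto simp: numeral_2_eq_2 length_Suc_conv)
    moreover have "i = 0 \<or> i = 1" using i by auto
    ultimately show ?thesis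
      using T unfolding trees_2 Vector_Spaces.linear_iff
      by (auto simp: vector_space_sD pi2_simps bilinear_simps scaleD_def mult.commute
          B.scale_right_distrib)
  qed
  moreover have "if set zs \<subseteq> A_part then pi2 T zs \<in> A_part else pi2 T zs \<in> B_part"
    if zs: "set zs \<subseteq> A_part \<union> B_part" for T and zs :: "('a \<times> 'b) list"
  proof (cases "T \<in> trees 2 \<and> length zs = 2")
    case True
    then obtain u v where "zs = [u, v]" by (auto simp: numeral_2_eq_2 length_Suc_conv)
    then show ?thesis
      using True zs unfolding trees_2
      by (auto simp: pi2_simps bilinear_simps A_part_def B_part_def)
  qed (simp add: pi2_eq_0 A_part_def B_part_def)
  ultimately show ?thesis
    by (simp add: h_space_def cochains_def pi2_eq_0)
qed

lemma opP_mem: "opP \<in> a_space sA sB 0"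
proof -
  have T_one: "T_one \<in> trees 1"
    by (simp add: trees_def T_one_def)
  have zero: "opP T zs = 0" if "\<not> (T = T_one \<and> length zs = 1)" for T zs
    using that by (auto simp: op_cochain_def split: list.split)
  have "Vector_Spaces.linear sD sD (\<lambda>z. opP T (zs[0 := z]))" if zs: "length zs = 1" for T zs
  proof -
    obtain u where "zs = [u]" using zs by (auto simp: length_Suc_conv)
    then show ?thesis
      unfolding Vector_Spaces.linear_iff
      by (cases "T = T_one")
        (auto simp: vector_space_sD opP_simps P_simps scaleD_def zero zero_prod_def)
  qed
  moreover have "if set zs \<subseteq> B_part then opP T zs \<in> A_part else opP T zs = 0"
    if zs: "set zs \<subseteq> A_part \<union> B_part" for T and zs :: "('a \<times> 'b) list"
  proof (cases "T = T_one \<and> length zs = 1")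
    case True
    then obtain u where "zs = [u]" by (auto simp: length_Suc_conv)
    then show ?thesis
      using True zs by (auto simp: opP_simps P_simps A_part_def B_part_def zero_prod_def)
  qed (simp add: zero A_part_def B_part_def)
  ultimately show ?thesis
    using T_one zero by (auto simp: a_space_def cochains_def)
qed

section \<open>Associativity\<close>

text \<open>On every tree the A-component is associativity of \<open>mu\<close>. In the B-component,
  \<open>Node [Leaf, S]\<close> gives the right module law, \<open>Node [S, Leaf]\<close> the left
  one, and \<open>Node [T_one, T_one]\<close> their compatibility. The three trees with a ternary
  root give the mixed laws for \<open>nu\<close> times \<open>lam\<close>, and the corolla gives
  associativity of \<open>nu\<close> times \<open>lam\<close> squared. Since \<open>lam\<close> is
  nonzero, these factors cancel.\<close>

lemma circ_pi2_eq_iff: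
  "circ 2 2 1 pi2 pi2 = circ 2 2 2 pi2 pi2 \<longleftrightarrow>
   associative_algebra sA mu \<and> associative_bimodule sA sB mu nu l r" (is "?L \<longleftrightarrow> ?R")
proof -
  have "?L \<longleftrightarrow>
     (\<forall>a b c. mu (mu a b) c = mu a (mu b c)) \<and> (\<forall>x y z. nu (nu x y) z = nu x (nu y z)) \<and>
     (\<forall>a b x. l (mu a b) x = l a (l b x)) \<and>
     (\<forall>a b x. r (l a x) b = l a (r x b)) \<and>
     (\<forall>a b x. r (r x a) b = r x (mu a b)) \<and>
     (\<forall>a x y. r (nu x y) a = nu x (r y a)) \<and>
     (\<forall>a x y. nu (r x a) y = nu x (l a y)) \<and>
     (\<forall>a x y. nu (l a x) y = l a (nu x y))"
    unfolding circ_2_2_eq_iff trees_3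
    by (simp add: R_trees_3 pi2_simps bilinear_simps lam all_conj_distrib del: One_nat_def)
      (intro iffI; elim conjE; intro conjI allI; simp only:)
  then show ?thesis
    using mu nu l r by (auto simp: associative_algebra_def associative_bimodule_def)
qed

text \<open>In degree 1 the sign before the second sum of the bracket is +1, so both sums agree. The
  factor 2 is written as a sum to match \<open>scaleD_half_double\<close>.\<close>

lemma lie_bracket_pi2:
  "lie_bracket 2 2 pi2 pi2 = (circ 2 2 1 pi2 pi2 - circ 2 2 2 pi2 pi2)
    + (circ 2 2 1 pi2 pi2 - circ 2 2 2 pi2 pi2)"
  by (simp add: lie_bracket_def sgn_mult_def numeral_2_eq_2)

section \<open>Brackets with the averaging operator\<close>

text \<open>As \<open>opP\<close> has one argument, the result again has two, so nested brackets
  with \<open>opP\<close> are iterates of this map.\<close>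

definition bracket_P :: "('a, 'b) cochain \<Rightarrow> ('a, 'b) cochain" where
  "bracket_P f = lie_bracket 2 1 f opP"

text \<open>\<open>P\<close> extended by zero to an endomorphism of the direct sum of A and B; its
  image lies in A, so its square is zero.\<close>

definition hat_P :: "'a \<times> 'b \<Rightarrow> 'a \<times> 'b" where "hat_P z = (P (snd z), 0)"

text \<open>All signs of the bracket are +1 because \<open>opP\<close> has degree 0, which leaves
  insertion into each argument minus application to the output.\<close>

lemma bracket_P_apply:
  assumes "T \<in> trees 2"
  shows "bracket_P f T [z, w] = f T [hat_P z, w] + f T [z, hat_P w] - hat_P (f T [z, w])"
proof -
  have "{1..2} = {1, 2 :: nat}" by auto
  moreover have "take 1 [z, w] = [z]" "drop 1 [z, w] = [w]" "take 2 [z, w] = [z, w]"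
    "drop 2 [z, w] = []" "take 1 [w] = [w]"
    by simp_all
  ultimately show ?thesis
    using assms
    by (simp add: bracket_P_def lie_bracket_def sgn_mult_def circ_def R_trees_2 opP_simps hat_P_def
        del: One_nat_def)
qed

lemma bracket_P_eq_0:
  assumes "\<not> (T \<in> trees 2 \<and> length zs = 2)"
  shows "bracket_P f T zs = 0"
  using assms by (auto simp: bracket_P_def lie_bracket_def sgn_mult_def circ_def numeral_2_eq_2)

lemma hat_P_simps: "hat_P (hat_P z) = 0" "hat_P (z + w) = hat_P z + hat_P w" "hat_P (z - w) = hat_P z - hat_P w"
  "hat_P (- z) = - hat_P z" "hat_P 0 = 0"
  by (simp_all add: hat_P_def P_simps prod_eq_iff)

text \<open>For the last identity: \<open>hat_P\<close> maps into A, \<open>pi2\<close> sends pairs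
  from A to A, and \<open>hat_P\<close> kills A.\<close>

lemma pi2_zero_arg:
  assumes "T \<in> trees 2"
  shows "pi2 T [0, w] = 0" "pi2 T [z, 0] = 0" "hat_P (pi2 T [hat_P z, hat_P w]) = 0"
  using assms
  by (auto simp: trees_2 pi2_simps bilinear_simps hat_P_def P_simps zero_prod_def)

lemma bracket_P_2:
  assumes "T \<in> trees 2"
  shows "bracket_P (bracket_P pi2) T [z, w] =
    (pi2 T [hat_P z, hat_P w] - hat_P (pi2 T [hat_P z, w]) - hat_P (pi2 T [z, hat_P w])) +
    (pi2 T [hat_P z, hat_P w] - hat_P (pi2 T [hat_P z, w]) - hat_P (pi2 T [z, hat_P w]))"
  using assms by (simp add: bracket_P_apply pi2_zero_arg hat_P_simps)

text \<open>Three copies of \<open>hat_P\<close> are distributed over two arguments and the output.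
  Either one place receives two of them, and the square is zero, or each receives one, and
  \<open>pi2_zero_arg\<close> applies.\<close>

lemma bracket_P_3: "bracket_P (bracket_P (bracket_P pi2)) = 0"
proof (rule cochain_2_eqI)
  fix T z w assume T: "T \<in> trees 2"
  show "bracket_P (bracket_P (bracket_P pi2)) T [z, w] = 0 T [z, w]"
    by (simp add: bracket_P_apply[OF T, of "bracket_P (bracket_P pi2)"] bracket_P_2[OF T]
        pi2_zero_arg[OF T] hat_P_simps)
qed (simp add: bracket_P_eq_0)

lemma bracket_P_0: "bracket_P 0 = 0"
  unfolding bracket_P_def using opP_mem by (intro lie_bracket_zero(2)[of _ sA sB]) (simp add: a_space_def)

lemma nested_bracket_opP: "nested_bracket 2 f (replicate j (1, opP)) = (bracket_P ^^ j) f"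
  by (induction j arbitrary: f) (simp_all add: funpow_swap1 bracket_P_def)

lemma bracket_P_funpow: "(bracket_P ^^ (j + 3)) pi2 = 0"
proof -
  have "(bracket_P ^^ j) 0 = 0" for j
    by (induction j) (simp_all only: funpow.simps o_apply id_apply bracket_P_0)
  then show ?thesis by (simp only: funpow_add o_apply numeral_3_eq_3 funpow.simps id_apply bracket_P_3)
qed

section \<open>The Maurer-Cartan equation\<close>

text \<open>All inputs have degree 0, so every Koszul sign is +1 and the k choices of the input that
  supplies \<open>pi2\<close> give equal terms. The minus sign comes from \<open>pi2\<close> having
  degree 1 before desuspension.\<close>

lemma linf_replicate:
  assumes "k \<ge> 2"
  shows "linf k (replicate k (0, pi2, opP)) =
    (if k = 2 then - lie_bracket 2 2 pi2 pi2 else 0,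
     \<Sum>i<k. proj_a ((bracket_P ^^ (k - 1)) pi2))"
proof -
  have "take i (replicate k u) @ drop (Suc i) (replicate k u) = replicate (k - 1) u"
    if "i < k" for i and u :: "int \<times> ('a, 'b) cochain \<times> ('a, 'b) cochain"
    using that by (simp flip: replicate_add)
  then show ?thesis
    using assms by (auto simp: linf_def Let_def sgn_mult_def nested_bracket_opP[unfolded One_nat_def]
        cong: sum.cong_simp)
qed

lemma linf_replicate_eq_0:
  assumes "k \<notin> {2, 3}"
  shows "linf k (replicate k (0, pi2, opP)) = 0"
proof (cases "k < 2")
  case False
  then have "4 \<le> k" using assms by auto
  \<comment> \<open>From four inputs on, \<open>pi2\<close> is bracketed with \<open>opP\<close> at
    least three times.\<close>
  then obtain j where "k = j + 4" using le_Suc_ex by (metis add.commute)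
  then show ?thesis
    using bracket_P_funpow[of j] by (subst linf_replicate) (simp_all add: zero_prod_def numeral_eq_Suc)
qed (simp add: linf_def Let_def zero_prod_def)

lemma scaleD_half_double: "sD (inverse 2) (z + z) = z"
proof -
  have "sA (inverse 2) (x + x) = x" "sB (inverse 2) (y + y) = y" for x y
    by (simp_all add: A.scale_right_distrib B.scale_right_distrib
        flip: A.scale_left_distrib B.scale_left_distrib)
  then show ?thesis by (simp add: scaleD_def prod_eq_iff)
qed

text \<open>The three equal terms of the cubic bracket, divided by 3!, leave the factor 1/2.\<close>

lemma scaleD_sixth_triple: "sD (inverse 6) (z + z + z) = sD (inverse 2) z"
  by (simp add: scaleD_def A.scale_right_distrib B.scale_right_distrib
      flip: A.scale_left_distrib B.scale_left_distrib)

lemma maurer_cartan_iff_components: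
  "maurer_cartan (scaleL sA sB) (L_space sA sB) linf (pi2, opP) \<longleftrightarrow>
     circ 2 2 1 pi2 pi2 = circ 2 2 2 pi2 pi2 \<and>
     (\<forall>T zs. proj_a (bracket_P pi2) T zs + sD (inverse 2) (proj_a (bracket_P (bracket_P pi2)) T zs) = 0)"
  (is "_ \<longleftrightarrow> ?rhs")
proof -
  let ?b = "\<lambda>k. linf k (replicate k (0, pi2, opP))"
  let ?t = "\<lambda>k. scaleL sA sB (inverse (of_nat (fact k))) (?b k)"
  let ?c = "circ 2 2 1 pi2 pi2 - circ 2 2 2 pi2 pi2"
  define S where "S = {k. k \<ge> 1 \<and> ?b k \<noteq> 0}"
  have S: "S \<subseteq> {2, 3}" using linf_replicate_eq_0 unfolding S_def by blast
  \<comment> \<open>Which of the two brackets are nonzero is unknown; the indices added to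
    \<open>S\<close> contribute zero.\<close>
  have "(\<Sum>k\<in>S. ?t k) = (\<Sum>k\<in>{2, 3}. ?t k)"
    using S by (intro sum.mono_neutral_left)
      (auto simp: S_def scaleL_def scaleD_def zero_prod_def fun_eq_iff)
  also have "\<dots> = ?t 2 + ?t 3" by simp
  also have "?t 2 = (- ?c, proj_a (bracket_P pi2))"
  proof -
    have "?b 2 = (- ?c + - ?c, proj_a (bracket_P pi2) + proj_a (bracket_P pi2))"
      by (simp add: linf_replicate lie_bracket_pi2 lessThan_nat_numeral lessThan_Suc)
    then show ?thesis
      by (simp only: scaleL_def fst_conv snd_conv plus_fun_apply scaleD_half_double fact_2 of_nat_numeral)
  qed
  also have "?t 3 = (0, \<lambda>T zs. sD (inverse 2) (proj_a (bracket_P (bracket_P pi2)) T zs))"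
  proof -
    have "?b 3 = (0, proj_a (bracket_P (bracket_P pi2)) + proj_a (bracket_P (bracket_P pi2)) +
        proj_a (bracket_P (bracket_P pi2)))"
      by (subst linf_replicate) (simp_all add: numeral_eq_Suc)
    moreover have "of_nat (fact 3) = (6 :: 'k)" by (simp add: fact_numeral)
    moreover have "sD c 0 = 0" for c by (simp add: scaleD_def zero_prod_def)
    ultimately show ?thesis
      by (simp only: scaleL_def fst_conv snd_conv plus_fun_apply zero_fun_apply scaleD_sixth_triple)
        (simp add: zero_fun_def)
  qed
  finally have sum: "(\<Sum>k\<in>S. ?t k) = (- ?c, proj_a (bracket_P pi2) +
      (\<lambda>T zs. sD (inverse 2) (proj_a (bracket_P (bracket_P pi2)) T zs)))"
    by (simp only: add_Pair add_0_right)
  have "(pi2, opP) \<in> L_space sA sB 0" "finite S"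
    using pi2_mem opP_mem finite_subset[OF S] by (simp_all add: L_space_def)
  then have "maurer_cartan (scaleL sA sB) (L_space sA sB) linf (pi2, opP) \<longleftrightarrow>
      (\<Sum>k\<in>S. ?t k) = 0"
    by (simp only: maurer_cartan_def S_def[symmetric] simp_thms)
  also have "\<dots> \<longleftrightarrow> ?c = 0 \<and> proj_a (bracket_P pi2) +
      (\<lambda>T zs. sD (inverse 2) (proj_a (bracket_P (bracket_P pi2)) T zs)) = 0"
    by (simp only: sum zero_prod_def prod.inject neg_equal_0_iff_equal)
  also have "\<dots> \<longleftrightarrow> ?rhs"
    by (simp only: right_minus_eq) (simp only: fun_eq_iff plus_fun_apply zero_fun_apply)
  finally show ?thesis .
qed

text \<open>On arguments from B the single bracket survives only at \<open>T_perp\<close>, as minus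
  \<open>lam\<close> times \<open>P (nu x y)\<close>. Half the double bracket gives
  \<open>mu (P x) (P y)\<close> on every tree, minus \<open>P (r x (P y))\<close> at
  \<open>T_dashv\<close> and minus \<open>P (l (P x) y)\<close> at \<open>T_vdash\<close>. Each tree
  thus equates \<open>mu (P x) (P y)\<close> with one of the other three expressions.\<close>

lemma proj_a_bracket_P_iff:
  "(\<forall>T zs. proj_a (bracket_P pi2) T zs + sD (inverse 2) (proj_a (bracket_P (bracket_P pi2)) T zs) = 0)
   \<longleftrightarrow> relative_averaging_operator sA sB lam mu nu l r P"
proof -
  let ?W = "\<lambda>T zs. proj_a (bracket_P pi2) T zs + sD (inverse 2) (proj_a (bracket_P (bracket_P pi2)) T zs)"
  have W0: "?W T zs = 0" if "\<not> (T \<in> trees 2 \<and> length zs = 2)" for T zs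
    using that by (auto simp: proj_a_def bracket_P_eq_0 scaleD_def zero_prod_def)
  have "(\<forall>T zs. ?W T zs = 0) \<longleftrightarrow> (\<forall>T\<in>trees 2. \<forall>z w. ?W T [z, w] = 0)" (is "?all \<longleftrightarrow> ?two")
  proof
    assume two: ?two
    show ?all
    proof (intro allI)
      fix T zs
      show "?W T zs = 0"
      proof (cases "T \<in> trees 2 \<and> length zs = 2")
        case True
        then obtain z w where "zs = [z, w]" by (auto simp: numeral_2_eq_2 length_Suc_conv)
        then show ?thesis using True two by blast
      qed (rule W0)
    qed
  qed blast
  also have "\<dots> \<longleftrightarrow> (\<forall>T\<in>trees 2. \<forall>x y.
    fst (bracket_P pi2 T [(0, x), (0, y)]) + fst (pi2 T [hat_P (0, x), hat_P (0, y)]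
      - hat_P (pi2 T [hat_P (0, x), (0, y)]) - hat_P (pi2 T [(0, x), hat_P (0, y)])) = 0)"
  proof -
    have "?W T [z, w] = (fst (bracket_P pi2 T [(0, x), (0, y)]) + fst (pi2 T [hat_P (0, x), hat_P (0, y)]
      - hat_P (pi2 T [hat_P (0, x), (0, y)]) - hat_P (pi2 T [(0, x), hat_P (0, y)])), 0)"
      if "T \<in> trees 2" "x = snd z" "y = snd w" for T z w x y
    proof -
      \<comment> \<open>The remaining factor 1/2 absorbs the doubling in
        \<open>bracket_P_2\<close>.\<close>
      have "sD (inverse 2) (fst (u + u), 0) = (fst u, 0)" for u :: "'a \<times> 'b"
        using scaleD_half_double[of "(fst u, 0)"] by simp
      then show ?thesis
        using that by (simp only: proj_a_def bracket_P_2 list.map add_Pair add_0_right)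
    qed
    then show ?thesis by (auto simp: zero_prod_def)
  qed
  also have "\<dots> \<longleftrightarrow> (\<forall>x y. mu (P x) (P y) = P (r x (P y)) \<and> mu (P x) (P y) = P (l (P x) y) \<and>
      mu (P x) (P y) = sA lam (P (nu x y)))"
    unfolding trees_2
    by (simp add: bracket_P_apply trees_2 pi2_simps hat_P_def bilinear_simps P_simps all_conj_distrib)
  also have "\<dots> \<longleftrightarrow> relative_averaging_operator sA sB lam mu nu l r P"
    using P by (simp add: relative_averaging_operator_def) metis
  finally show ?thesis .
qed

lemma maurer_cartan_iff:
  "maurer_cartan (scaleL sA sB) (L_space sA sB) linf (pi2, opP) \<longleftrightarrow>
   relative_averaging_algebra sA sB lam mu nu l r P"
  unfolding maurer_cartan_iff_components circ_pi2_eq_iff proj_a_bracket_P_iff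
  by (auto simp: relative_averaging_algebra_def)

end

theorem theorem5p11:
  fixes sA :: "'k::field_char_0 \<Rightarrow> 'a::ab_group_add \<Rightarrow> 'a"
    and sB :: "'k \<Rightarrow> 'b::ab_group_add \<Rightarrow> 'b"
    and lam :: 'k
    and mu :: "'a \<Rightarrow> 'a \<Rightarrow> 'a"
    and nu :: "'b \<Rightarrow> 'b \<Rightarrow> 'b"
    and l :: "'a \<Rightarrow> 'b \<Rightarrow> 'b"
    and r :: "'b \<Rightarrow> 'a \<Rightarrow> 'b"
    and P :: "'b \<Rightarrow> 'a"
  assumes "vector_space sA" and "vector_space sB" and "lam \<noteq> 0"
    and "bilinear_map sA sA sA mu"
    and "bilinear_map sB sB sB nu"
    and "bilinear_map sA sB sB l"
    and "bilinear_map sB sA sB r"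
    and "Vector_Spaces.linear sB sA P"
  shows "relative_averaging_algebra sA sB lam mu nu l r P \<longleftrightarrow>
    maurer_cartan (scaleL sA sB) (L_space sA sB) linf
      (pi_cochain sB lam mu nu l r, op_cochain P)"
proof -
  interpret averaging_data sA sB lam mu nu l r P
    using assms by (simp add: averaging_data_def averaging_data_axioms_def)
  show ?thesis by (rule maurer_cartan_iff[symmetric])
qed

end
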